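(* For all integers $r\ge1$ and all $(\alpha;\beta)=(\alpha_1,\dots,\alpha_{r+1};\beta_1,\dots,\beta_r)\in\mathcal{U}_r$ for which no $\beta_i+1$ is a non-positive integer, $$ {}_{r+2}F_{r+1}\left(\begin{array}{c}\alpha_1,\,\ldots,\,\alpha_{r+1},\,A\\ \beta_1+1,\,\ldots,\,\beta_r+1,\,B\end{array}\right) =\left(\frac{B-A}{B}\right) {}_{r+2}F_{r+1}\left(\begin{array}{c}\alpha_1+1,\,\ldots,\,\alpha_{r+1}+1,\,A\\ \beta_1+1,\,\ldots,\,\beta_r+1,\,B+1\end{array}\right) $$ for all $A,B\in\mathbb{C}$, provided $\operatorname{Re}(B-A)>0$ and $B$ is not a non-positive integer.
   Context: ${}_{p+1}F_p\left(\begin{array}{c}a_1,\ldots,a_{p+1}\\ b_1,\ldots,b_p\end{array}\right)$ with no argument shown means the hypergeometric series at argument $1$: $\sum_{k\ge0}\frac{(a_1)_k\cdots(a_{p+1})_k}{(b_1)_k\cdots(b_p)_k\,k!}$, where $(a)_k=a(a+1)\cdots(a+k-1)$, $(a)_0=1$. It converges if $\operatorname{Re}\left(\sum_i b_i-\sum_i a_i\right)>0$. For each $r\ge1$, $\mathcal{U}_r\subset\mathbb{C}^{r+1}\times\mathbb{C}^r$ is the set of all $(\alpha;\beta)$ satisfying the $r$ equations $S_k(\alpha)=S_k(\beta)$, $k=1,\dots,r$, where $S_k(\alpha)$ and $S_k(\beta)$ are the $k$-th elementary symmetric polynomials in $\alpha_1,\dots,\alpha_{r+1}$ and in $\beta_1,\dots,\beta_r$,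 respectively. *)

theory Defs
  imports "HOL-Analysis.Analysis"
begin

text \<open>
  Parameter vectors are lists. The library's generalised hypergeometric power series
  \<^term>\<open>fps_hypergeo as bs c\<close> takes the scaling \<^term>\<open>c\<close> of the argument into its
  coefficients, so for \<^term>\<open>c = 1\<close> its coefficients are the terms of the series at argument 1.
\<close>

abbreviation hypergeo1_term :: "complex list \<Rightarrow> complex list \<Rightarrow> nat \<Rightarrow> complex" where
  "hypergeo1_term as bs \<equiv> fps_nth (fps_hypergeo as bs 1)"

definition hypergeo1 :: "complex list \<Rightarrow> complex list \<Rightarrow> complex" where
  "hypergeo1 as bs = (\<Sum>k. hypergeo1_term as bs k)"

lemma hypergeo1_term_eq:
  "hypergeo1_term as bs k =
     prod_list (map (\<lambda>a. pochhammer a k) as) /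
     (prod_list (map (\<lambda>b. pochhammer b k) bs) * fact k)"
proof -
  have "foldl (\<lambda>r a. r * pochhammer a k) v xs = v * prod_list (map (\<lambda>a. pochhammer a k) xs)"
    for v :: complex and xs
    by (induction xs arbitrary: v) (auto simp: mult.assoc)
  then show ?thesis
    by simp
qed

definition elem_sym :: "nat \<Rightarrow> complex list \<Rightarrow> complex" where
  "elem_sym k xs = (\<Sum>I | I \<subseteq> {..<length xs} \<and> card I = k. \<Prod>i\<in>I. xs ! i)"

definition U_set :: "nat \<Rightarrow> (complex list \<times> complex list) set" where
  "U_set r = {(\<alpha>, \<beta>). length \<alpha> = r + 1 \<and> length \<beta> = r \<and>
                (\<forall>k\<in>{1..r}. elem_sym k \<alpha> = elem_sym k \<beta>)}"

end

theory Submission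
  imports Defs
begin

text \<open>
  The equations defining \<^term>\<open>U_set r\<close> say that
  $\prod_i (x + \alpha_i) - x \prod_i (x + \beta_i)$ is the constant $P = \prod_i \alpha_i$.
  Put $U_k = \prod_i (\alpha_i + 1)_k / (k! \prod_i (\beta_i + 1)_k)$ and $w_k = (A)_k / (B)_k$.
  Taking $x = k$ in the identity turns the left-hand series into
  $\sum_k (U_k - U_{k-1}) w_k$ with $U_{-1} = 0$, and summation by parts yields the right-hand
  series, since $w_k - w_{k+1} = \frac{B - A}{B} (A)_k / (B + 1)_k$. The boundary term
  $U_n w_n$ is of order $n^{\mathrm{Re}(A - B)}$, because $\sum \alpha_i = \sum \beta_i$.
\<close>

section \<open>Elementary symmetric polynomials and the polynomial identity\<close>

text \<open>Vieta's formula: each factor contributes either \<open>x\<close> or its own entry, and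
  the choices are sorted by how many entries they take.\<close>

lemma prod_list_add_eq_sum_elem_sym:
  "prod_list (map (\<lambda>a. x + a) xs) = (\<Sum>k\<le>length xs. elem_sym k xs * x ^ (length xs - k))"
proof -
  let ?N = "{..<length xs}"
  have "prod_list (map (\<lambda>a. x + a) xs) = (\<Prod>i<length xs. xs ! i + x)"
    by (simp add: prod.list_conv_set_nth atLeast0LessThan add.commute)
  also have "\<dots> = (\<Sum>I\<in>Pow ?N. (\<Prod>i\<in>I. xs ! i) * (\<Prod>i\<in>?N - I. x))"
    by (rule prod_add) simp
  also have "\<dots> = (\<Sum>I\<in>Pow ?N. (\<Prod>i\<in>I. xs ! i) * x ^ (length xs - card I))"
    by (intro sum.cong) (auto simp: card_Diff_subset finite_subset)
  also have "\<dots> = (\<Sum>k\<le>length xs. \<Sum>I | I \<in> Pow ?N \<and> card I = k.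
                    (\<Prod>i\<in>I. xs ! i) * x ^ (length xs - card I))"
    by (intro sum.group [symmetric]) (auto dest: card_mono [rotated])
  also have "\<dots> = (\<Sum>k\<le>length xs. elem_sym k xs * x ^ (length xs - k))"
    unfolding elem_sym_def sum_distrib_right by (intro sum.cong) auto
  finally show ?thesis .
qed

lemma elem_sym_0: "elem_sym 0 xs = 1"
proof -
  have "{I. I \<subseteq> {..<length xs} \<and> card I = 0} = {{}}"
    by (auto dest: finite_subset [OF _ finite_lessThan])
  then show ?thesis
    by (simp add: elem_sym_def)
qed

lemma elem_sym_1: "elem_sym 1 xs = sum_list xs"
proof -
  have "{I. I \<subseteq> {..<length xs} \<and> card I = 1} = (\<lambda>i. {i}) ` {..<length xs}"
    by (auto simp: card_1_singleton_iff)
  then show ?thesis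
    by (simp add: elem_sym_def sum.reindex sum_list_sum_nth atLeast0LessThan)
qed

text \<open>At \<open>x = 0\<close> only the top summand of Vieta's formula survives, since
  \<open>0 ^ 0 = 1\<close>.\<close>

lemma elem_sym_length: "elem_sym (length xs) xs = prod_list xs"
  using prod_list_add_eq_sum_elem_sym [of 0 xs]
  by (simp add: power_0_left if_distrib eq_commute [of _ "length xs"] cong: if_cong)

lemma U_set_sum_list:
  assumes "(\<alpha>, \<beta>) \<in> U_set r" "r \<ge> 1"
  shows "sum_list \<alpha> = sum_list \<beta>"
  using assms by (auto simp: U_set_def simp flip: elem_sym_1)

text \<open>Together with S_0 = 1, the r equations match all coefficients but the constant one of
  the \<alpha>-product. The extra factor \<open>x\<close> makes up for \<beta> being one entry
  shorter.\<close>

lemma U_set_prod_list: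
  assumes "(\<alpha>, \<beta>) \<in> U_set r"
  shows "prod_list (map (\<lambda>a. x + a) \<alpha>) = x * prod_list (map (\<lambda>b. x + b) \<beta>) + prod_list \<alpha>"
proof -
  have len: "length \<alpha> = Suc r" "length \<beta> = r"
    using assms by (auto simp: U_set_def)
  have eq: "elem_sym k \<alpha> = elem_sym k \<beta>" if "k \<le> r" for k
    using assms that by (cases "k = 0") (auto simp: U_set_def elem_sym_0)
  have "prod_list (map (\<lambda>a. x + a) \<alpha>) =
          (\<Sum>k\<le>r. elem_sym k \<alpha> * x ^ (Suc r - k)) + elem_sym (Suc r) \<alpha>"
    by (simp add: prod_list_add_eq_sum_elem_sym len)
  also have "(\<Sum>k\<le>r. elem_sym k \<alpha> * x ^ (Suc r - k)) = x * (\<Sum>k\<le>r. elem_sym k \<beta> * x ^ (r - k))"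
    unfolding sum_distrib_left by (intro sum.cong) (auto simp: eq Suc_diff_le)
  finally show ?thesis
    using elem_sym_length [of \<alpha>] by (simp add: prod_list_add_eq_sum_elem_sym len)
qed

section \<open>Growth of the terms of the series\<close>

text \<open>The quotient is n^(a - b) times a quotient of Euler's approximations
  \<open>rGamma_series\<close>, which converges because 1/Gamma does not vanish at \<open>b\<close>.
  The index \<open>Suc n\<close> is the one occurring in \<open>rGamma_series _ n\<close>.\<close>

lemma pochhammer_quotient_bigo:
  fixes a b :: complex
  assumes "b \<notin> \<int>\<^sub>\<le>\<^sub>0"
  shows "(\<lambda>n. norm (pochhammer a (Suc n) / pochhammer b (Suc n))) \<in> O(\<lambda>n. real n powr Re (a - b))"
proof -
  let ?q = "\<lambda>n. norm (rGamma_series a n / rGamma_series b n)"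
  have "(\<lambda>n. rGamma_series a n / rGamma_series b n) \<longlonglongrightarrow> rGamma a / rGamma b"
    using assms by (intro tendsto_intros) (simp add: rGamma_eq_zero_iff)
  then have "?q \<in> O(\<lambda>_. 1)"
    by (intro bigoI_tendsto [where c = "norm (rGamma a / rGamma b)"])
       (auto simp: tendsto_norm simp flip: norm_divide)
  then have "(\<lambda>n. ?q n * real n powr Re (a - b)) \<in> O(\<lambda>n. 1 * real n powr Re (a - b))"
    by (rule landau_o.big.mult) simp
  moreover have "eventually (\<lambda>n. ?q n * real n powr Re (a - b) =
                   norm (pochhammer a (Suc n) / pochhammer b (Suc n))) sequentially"
    using eventually_gt_at_top [of 0]
  proof eventually_elim
    case (elim n)
    then show ?case
      by (simp add: rGamma_series_def norm_divide norm_mult powr_def exp_diff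
                    left_diff_distrib right_diff_distrib mult.commute)
  qed
  ultimately show ?thesis
    by (simp only: mult_1 landau_o.big.in_cong)
qed

lemma pochhammer_prod_list_quotient_bigo:
  fixes as bs :: "complex list"
  assumes "length as = length bs" and "\<And>b. b \<in> set bs \<Longrightarrow> b \<notin> \<int>\<^sub>\<le>\<^sub>0"
  shows "(\<lambda>n. norm (prod_list (map (\<lambda>a. pochhammer a (Suc n)) as) /
                    prod_list (map (\<lambda>b. pochhammer b (Suc n)) bs)))
           \<in> O(\<lambda>n. real n powr Re (sum_list as - sum_list bs))"
  using assms
proof (induction as bs rule: list_induct2)
  case Nil
  \<comment> \<open>The empty quotient is 1, but \<open>0 powr 0 = 0\<close>, so
    \<open>n = 0\<close> must be excluded.\<close>
  have "eventually (\<lambda>n. real n powr 0 = 1) sequentially"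
    using eventually_gt_at_top [of 0] by eventually_elim simp
  then show ?case
    by (simp cong: landau_o.big.cong)
next
  case (Cons a as b bs)
  have "(\<lambda>n. norm (pochhammer a (Suc n) / pochhammer b (Suc n)) *
          norm (prod_list (map (\<lambda>a. pochhammer a (Suc n)) as) /
                prod_list (map (\<lambda>b. pochhammer b (Suc n)) bs)))
        \<in> O(\<lambda>n. real n powr Re (a - b) * real n powr Re (sum_list as - sum_list bs))"
    using Cons by (intro landau_o.big.mult pochhammer_quotient_bigo) auto
  then show ?case
    by (simp add: norm_mult norm_divide algebra_simps flip: powr_add)
qed

text \<open>The $-1$ in the exponent comes from $k! = (1)_k$, which acts as a further lower parameter $1$.\<close>

lemma hypergeo1_term_bigo:
  assumes "length as = Suc (length bs)" and "\<And>b. b \<in> set bs \<Longrightarrow> b \<notin> \<int>\<^sub>\<le>\<^sub>0"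
  shows "(\<lambda>n. norm (hypergeo1_term as bs (Suc n)))
           \<in> O(\<lambda>n. real n powr (Re (sum_list as - sum_list bs) - 1))"
proof -
  have "b \<notin> \<int>\<^sub>\<le>\<^sub>0" if "b \<in> set (1 # bs)" for b
    using assms(2) that by auto
  with assms(1) show ?thesis
    using pochhammer_prod_list_quotient_bigo [of as "1 # bs"]
    by (simp add: hypergeo1_term_eq pochhammer_fact algebra_simps del: fps_hypergeo_nth)
qed

text \<open>The exponent in the growth bound is below -1, so a convergent power series of n
  dominates.\<close>

lemma summable_hypergeo1_term:
  assumes "length as = Suc (length bs)" and "\<And>b. b \<in> set bs \<Longrightarrow> b \<notin> \<int>\<^sub>\<le>\<^sub>0"
    and "Re (sum_list bs - sum_list as) > 0"
  shows "summable (hypergeo1_term as bs)"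
proof -
  have "summable (\<lambda>n. norm (real n powr (Re (sum_list as - sum_list bs) - 1)))"
    using assms(3) by (simp add: summable_real_powr_iff)
  then have "summable (\<lambda>n. norm (hypergeo1_term as bs (Suc n)))"
    using hypergeo1_term_bigo [OF assms(1,2)] by (rule summable_comparison_test_bigo)
  then show ?thesis
    using summable_Suc_iff summable_norm_cancel by blast
qed

text \<open>A negative exponent in the growth bound is enough here. This covers boundary terms whose
  own series may diverge.\<close>

lemma hypergeo1_term_tendsto_0:
  assumes "length as = Suc (length bs)" and "\<And>b. b \<in> set bs \<Longrightarrow> b \<notin> \<int>\<^sub>\<le>\<^sub>0"
    and "Re (sum_list bs - sum_list as) > - 1"
  shows "hypergeo1_term as bs \<longlonglongrightarrow> 0"
proof -
  have "(\<lambda>n. real n powr (Re (sum_list as - sum_list bs) - 1)) \<longlonglongrightarrow> 0"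
    using assms(3) by (intro tendsto_neg_powr filterlim_real_sequentially) auto
  then have "(\<lambda>n. real n powr (Re (sum_list as - sum_list bs) - 1)) \<in> o(\<lambda>_. 1)"
    by (intro smalloI_tendsto) auto
  with hypergeo1_term_bigo [OF assms(1,2)]
  have "(\<lambda>n. norm (hypergeo1_term as bs (Suc n))) \<in> o(\<lambda>_. 1)"
    by (rule landau_o.big_small_trans)
  then have "(\<lambda>n. norm (hypergeo1_term as bs (Suc n))) \<longlonglongrightarrow> 0"
    using smalloD_tendsto by fastforce
  then show ?thesis
    by (simp add: tendsto_norm_zero_iff filterlim_sequentially_Suc del: fps_hypergeo_nth)
qed

section \<open>Summation by parts and the transformation\<close>

text \<open>With \<open>G k\<close> = U_k w_k, the two terms on the left are (U_{k+1} - U_k) w_{k+1}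
  and U_k (w_k - w_{k+1}); their difference telescopes.\<close>

lemma hypergeo1_term_telescope:
  fixes \<alpha> \<beta> :: "complex list" and A B :: complex
  assumes U: "(\<alpha>, \<beta>) \<in> U_set r"
    and \<beta>: "\<And>b. b \<in> set \<beta> \<Longrightarrow> b + 1 \<notin> \<int>\<^sub>\<le>\<^sub>0"
    and B: "B \<notin> \<int>\<^sub>\<le>\<^sub>0"
  defines "G \<equiv> hypergeo1_term (map (\<lambda>a. a + 1) \<alpha> @ [A]) (map (\<lambda>b. b + 1) \<beta> @ [B])"
  shows "hypergeo1_term (\<alpha> @ [A]) (map (\<lambda>b. b + 1) \<beta> @ [B]) (Suc k) -
           (B - A) / B *
             hypergeo1_term (map (\<lambda>a. a + 1) \<alpha> @ [A]) (map (\<lambda>b. b + 1) \<beta> @ [B + 1]) k =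
         G (Suc k) - G k"
proof -
  define p where "p k = prod_list (map (\<lambda>a. pochhammer (a + 1) k) \<alpha>)" for k
  define q where "q k = prod_list (map (\<lambda>b. pochhammer (b + 1) k) \<beta>)" for k
  define P X Y K where "P = prod_list \<alpha>"
    and "X = prod_list (map (\<lambda>a. of_nat (Suc k) + a) \<alpha>)"
    and "Y = prod_list (map (\<lambda>b. of_nat (Suc k) + b) \<beta>)"
    and "K = (of_nat (Suc k) :: complex)"
  have prod_list_mult: "prod_list (map (\<lambda>x. f x * g x) xs) = prod_list (map f xs) * prod_list (map g xs)"
    for f g :: "complex \<Rightarrow> complex" and xs
    by (induction xs) auto
  \<comment> \<open>The polynomial identity at x = k + 1. As U_{k+1} / U_k =
    \<open>X / (K * Y)\<close>, it gives U_{k+1} - U_k = U_k \<open>P / (K * Y)\<close>.\<close>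
  have X: "X = K * Y + P"
    unfolding X_def Y_def P_def K_def by (rule U_set_prod_list [OF U])
  \<comment> \<open>Splitting off the first factor, (a)_{k+1} = a (a+1)_k, is what relates the
    unshifted parameters \<alpha> to \<open>p\<close>.\<close>
  have shift: "prod_list (map (\<lambda>a. pochhammer a (Suc k)) \<alpha>) = P * p k"
    by (simp add: P_def p_def pochhammer_rec prod_list_mult)
  have p_Suc: "p (Suc k) = p k * X" and q_Suc: "q (Suc k) = q k * Y"
    by (simp_all add: p_def q_def X_def Y_def pochhammer_Suc prod_list_mult add_ac)
  have "q j \<noteq> 0" for j
    using \<beta> by (fastforce simp: q_def prod_list_zero_iff pochhammer_eq_0_iff)
  \<comment> \<open>\<open>Y\<close> is a factor of \<open>q (Suc k)\<close>.\<close>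
  then have q0: "q k \<noteq> 0" "Y \<noteq> 0"
    using q_Suc by force+
  have K0: "K \<noteq> 0"
    unfolding K_def by (rule of_nat_neq_0)
  have Bk: "B + of_nat k \<noteq> 0"
    using B by (metis add.commute add_eq_0_iff minus_of_nat_in_nonpos_Ints)
  have B0: "B \<noteq> 0" "pochhammer B k \<noteq> 0"
    using B by (auto simp: pochhammer_eq_0_iff)
  have B1: "pochhammer (B + 1) k = pochhammer B k * (B + of_nat k) / B"
    using B0 pochhammer_rec [of B k] pochhammer_Suc [of B k] by (simp add: field_simps)
  \<comment> \<open>\<open>m\<close> is \<open>G k\<close>. All other terms are expressed as
    multiples of it, which leaves an identity between the rational functions \<open>?l\<close>,
    \<open>?r\<close> and \<open>?g\<close>.\<close>
  define m where "m = p k * pochhammer A k / (q k * pochhammer B k * fact k)"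
  let ?l = "P * (A + of_nat k) / (Y * K * (B + of_nat k))"
  let ?r = "B / (B + of_nat k)"
  let ?g = "X * (A + of_nat k) / (Y * K * (B + of_nat k))"
  have L: "hypergeo1_term (\<alpha> @ [A]) (map (\<lambda>b. b + 1) \<beta> @ [B]) (Suc k) = m * ?l"
  proof -
    have "hypergeo1_term (\<alpha> @ [A]) (map (\<lambda>b. b + 1) \<beta> @ [B]) (Suc k) =
            prod_list (map (\<lambda>a. pochhammer a (Suc k)) \<alpha>) * pochhammer A (Suc k) /
              (q (Suc k) * pochhammer B (Suc k) * fact (Suc k))"
      by (simp add: hypergeo1_term_eq o_def q_def del: fps_hypergeo_nth fact_Suc)
    also have "\<dots> = m * ?l"
      unfolding shift q_Suc m_def unfolding pochhammer_Suc fact_Suc K_def by (simp add: mult_ac del: of_nat_Suc)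
    finally show ?thesis .
  qed
  have R: "hypergeo1_term (map (\<lambda>a. a + 1) \<alpha> @ [A]) (map (\<lambda>b. b + 1) \<beta> @ [B + 1]) k = m * ?r"
    by (simp add: hypergeo1_term_eq o_def B1 m_def p_def q_def del: fps_hypergeo_nth)
  have G: "G j = p j * pochhammer A j / (q j * pochhammer B j * fact j)" for j
    by (simp add: G_def hypergeo1_term_eq o_def p_def q_def del: fps_hypergeo_nth)
  have G_Suc: "G (Suc k) = m * ?g"
    unfolding G p_Suc q_Suc m_def pochhammer_Suc fact_Suc K_def by (simp add: mult_ac del: of_nat_Suc)
  have eq: "?l - (B - A) / B * ?r = ?g - 1"
  proof -
    \<comment> \<open>Substituting \<open>K * Y + P\<close> for \<open>X\<close> splits
      \<open>?g\<close> into w_{k+1} / w_k and \<open>?l\<close>; the ratio w_{k+1} / w_k then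
      cancels against the one in the \<open>?r\<close> term.\<close>
    have "?g = (A + of_nat k) / (B + of_nat k) + ?l"
    proof -
      have "(K * Y + P) * a / (Y * K * b) = a / b + P * a / (Y * K * b)" if "b \<noteq> 0" for a b
        using that q0(2) K0 by (simp add: field_simps)
      then show ?thesis
        unfolding X using Bk by blast
    qed
    moreover have "(B - A) / B * ?r = 1 - (A + of_nat k) / (B + of_nat k)"
    proof -
      have "(B - A) / B * ?r = ((B + of_nat k) - (A + of_nat k)) / (B + of_nat k)"
        using B0(1) by simp
      then show ?thesis
        by (simp only: diff_divide_distrib [of "B + of_nat k"] divide_self [OF Bk])
    qed
    ultimately show ?thesis
      by simp
  qed
  have "m * ?l - (B - A) / B * (m * ?r) = m * (?l - (B - A) / B * ?r)"
    by (simp only: right_diff_distrib mult.left_commute)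
  also have "\<dots> = m * ?g - m"
    by (simp only: eq right_diff_distrib mult_1_right)
  finally show ?thesis
    unfolding L R G_Suc by (simp only: G m_def)
qed

theorem theorem2p5:
  fixes r :: nat and \<alpha> \<beta> :: "complex list" and A B :: complex
  assumes "r \<ge> 1"
    and "(\<alpha>, \<beta>) \<in> U_set r"
    and "\<And>b. b \<in> set \<beta> \<Longrightarrow> b + 1 \<notin> \<int>\<^sub>\<le>\<^sub>0"
    and "Re (B - A) > 0"
    and "B \<notin> \<int>\<^sub>\<le>\<^sub>0"
  shows "summable (hypergeo1_term (\<alpha> @ [A]) (map (\<lambda>b. b + 1) \<beta> @ [B])) \<and>
         summable (hypergeo1_term (map (\<lambda>a. a + 1) \<alpha> @ [A]) (map (\<lambda>b. b + 1) \<beta> @ [B + 1])) \<and>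
         hypergeo1 (\<alpha> @ [A]) (map (\<lambda>b. b + 1) \<beta> @ [B]) =
           (B - A) / B * hypergeo1 (map (\<lambda>a. a + 1) \<alpha> @ [A]) (map (\<lambda>b. b + 1) \<beta> @ [B + 1])"
proof -
  define L where "L = hypergeo1_term (\<alpha> @ [A]) (map (\<lambda>b. b + 1) \<beta> @ [B])"
  define R where "R = hypergeo1_term (map (\<lambda>a. a + 1) \<alpha> @ [A]) (map (\<lambda>b. b + 1) \<beta> @ [B + 1])"
  define G where "G = hypergeo1_term (map (\<lambda>a. a + 1) \<alpha> @ [A]) (map (\<lambda>b. b + 1) \<beta> @ [B])"
  have len: "length \<alpha> = Suc r" "length \<beta> = r"
    using assms(2) by (auto simp: U_set_def)
  have sum: "sum_list \<alpha> = sum_list \<beta>"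
    using assms(1,2) by (intro U_set_sum_list)
  have sum_list_add_1: "sum_list (map (\<lambda>x. x + 1) xs) = sum_list xs + of_nat (length xs)"
    for xs :: "complex list"
    by (induction xs) auto
  have B1: "B + 1 \<notin> \<int>\<^sub>\<le>\<^sub>0"
    using assms(5) plus_one_in_nonpos_Ints_imp by blast
  \<comment> \<open>Lower minus upper parameter sum is B - A + r for \<open>L\<close> and B - A for
    \<open>R\<close>.\<close>
  have L: "summable L"
    unfolding L_def using assms(3-5)
    by (intro summable_hypergeo1_term) (auto simp: len sum sum_list_add_1)
  have R: "summable R"
    unfolding R_def using assms(3,4) B1
    by (intro summable_hypergeo1_term) (auto simp: len sum sum_list_add_1)
  \<comment> \<open>Shifting r + 1 upper but only r lower parameters reduces the difference of
    parameter sums to B - A - 1, whose real part still exceeds -1.\<close>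
  have "G \<longlonglongrightarrow> 0"
    unfolding G_def using assms(3-5)
    by (intro hypergeo1_term_tendsto_0) (auto simp: len sum sum_list_add_1)
  then have "(\<lambda>k. G (Suc k) - G k) sums (0 - G 0)"
    by (rule telescope_sums)
  moreover have "(\<lambda>k. G (Suc k) - G k) = (\<lambda>k. L (Suc k) - (B - A) / B * R k)"
    unfolding G_def L_def R_def
    by (rule ext, rule hypergeo1_term_telescope [OF assms(2,3,5), symmetric])
  moreover have "(\<lambda>k. L (Suc k) - (B - A) / B * R k) sums ((suminf L - L 0) - (B - A) / B * suminf R)"
    using L R by (intro sums_diff sums_mult summable_sums) (simp add: sums_Suc_iff summable_sums)+
  ultimately have "(suminf L - L 0) - (B - A) / B * suminf R = - G 0"
    using sums_unique2 by fastforce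
  \<comment> \<open>The telescoped series starts at \<open>L 1\<close>; the missing
    \<open>L 0\<close> cancels against \<open>G 0\<close>.\<close>
  moreover have "L 0 = 1" "G 0 = 1"
    by (simp_all add: L_def G_def hypergeo1_term_eq o_def map_replicate_const del: fps_hypergeo_nth)
  ultimately have "suminf L = (B - A) / B * suminf R"
    by simp
  then show ?thesis
    using L R by (simp add: L_def R_def hypergeo1_def del: fps_hypergeo_nth)
qed

end
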